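(* Let $\beta\in\mathbb{R}^p$ have $m$ clusters $\mathcal{C}_1,\dots,\mathcal{C}_m$ with values $c_1>c_2>\cdots>c_m\ge 0$, let $k\in\{1,\dots,m\}$, let $\lambda_1\ge\cdots\ge\lambda_p\ge 0$, and let $H:\mathbb{R}\to\mathbb{R}$ be the partial sorted $\ell_1$ norm with respect to the $k$-th cluster (all as defined in the context). Let $c^{\setminus k}=\{c_1,\dots,c_{k-1},c_{k+1},\dots,c_m\}$. Let $\varepsilon_c>0$ be such that $$\varepsilon_c<|c_i-c_j|\quad\text{for all } i\ne j,\qquad\text{and}\qquad \varepsilon_c<c_m\ \text{ if } c_m\neq 0 .$$ Then for every $z\in\mathbb{R}$ and every $\delta\in\{-1,1\}$, the directional derivative of $H$ at $z$ in the direction $\delta$ is $$H'(z;\delta)=\begin{cases}\displaystyle\sum_{j\in C(\varepsilon_c)}\lambda_{(j)^-_{\varepsilon_c}} & \text{if } z=0,\\[2ex] \displaystyle\operatorname{sign}(z)\,\delta\sum_{j\in C(z+\varepsilon_c\delta)}\lambda_{(j)^-_{z+\varepsilon_c\delta}} & \text{if } |z|\in c^{\setminus k}\setminus\{0\},\\[2ex] \displaystyle\operatorname{sign}(z)\,\delta\sum_{j\in C(z)}\lambda_{(j)^-_{z}} & \text{otherwise.}\end{cases}$$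
   Context: Conventions: $\operatorname{sign}(x)=x/|x|$ for $x\neq0$ and $\operatorname{sign}(0)=1$. The sequence $\lambda_1\ge\lambda_2\ge\cdots\ge\lambda_p\ge0$ is fixed. Clusters: for a fixed $\beta\in\mathbb{R}^p$ such that $|\beta_j|$ takes exactly $m$ distinct values $c_1>c_2>\cdots>c_m\ge0$, the clusters are $\mathcal{C}_i=\{j:|\beta_j|=c_i\}$, $i=1,\dots,m$. For $z\in\mathbb{R}$ define $\beta(z)\in\mathbb{R}^p$ by $\beta_i(z)=\operatorname{sign}(\beta_i)\,z$ if $i\in\mathcal{C}_k$ and $\beta_i(z)=\beta_i$ otherwise. Sorting permutation: for $z\in\mathbb{R}$ choose a permutation $i\mapsto(i)_z$ of $\{1,\dots,p\}$ with $|\beta(z)_{(1)_z}|\ge|\beta(z)_{(2)_z}|\ge\cdots\ge|\beta(z)_{(p)_z}|$, and let $j\mapsto(j)^-_z$ be its inverse, so $(j)^-_z$ is the rank of index $j$ in the non-increasing ordering of $|\beta(z)|$. Ties may be broken arbitrarily; this does not affect the quantities below. Partial sorted $\ell_1$ norm with respect to the $k$-th cluster: $$H(z)=|z|\sum_{j\in\mathcal{C}_k}\lambda_{(j)^-_z}+\sum_{j\notin\mathcal{C}_k}|\beta_j|\,\lambda_{(j)^-_z}.$$ For $z\in\mathbb{R}$, $C(z)=\{j:|\beta(z)_j|=|z|\}$. The directional derivative is $H'(z;\delta)=\lim_{h\downarrow0}\frac{H(z+h\delta)-H(z)}{h}$. *)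

theory Defs
  imports "HOL-Analysis.Analysis" "HOL-Combinatorics.Permutations"
begin

text \<open>
  Vectors in p-dimensional real space, and the sequence of penalty weights, are
  functions of type \<open>nat \<Rightarrow> real\<close> of which only the values on the index set \<open>{1..p}\<close> are
  used. Likewise only the values of \<open>c\<close> on \<open>{1..m}\<close> are used.
\<close>

text \<open>Unlike \<open>sgn\<close>, this sign function takes the value 1 at 0.\<close>

definition sign1 :: "real \<Rightarrow> real" where
  "sign1 x = (if x = 0 then 1 else x / \<bar>x\<bar>)"

definition cluster_values :: "nat \<Rightarrow> (nat \<Rightarrow> real) \<Rightarrow> nat \<Rightarrow> (nat \<Rightarrow> real) \<Rightarrow> bool" where
  "cluster_values p \<beta> m c \<longleftrightarrow>
     strict_antimono_on {1..m} c \<and> (\<lambda>j. \<bar>\<beta> j\<bar>) ` {1..p} = c ` {1..m}"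

definition cluster :: "nat \<Rightarrow> (nat \<Rightarrow> real) \<Rightarrow> (nat \<Rightarrow> real) \<Rightarrow> nat \<Rightarrow> nat set" where
  "cluster p \<beta> c i = {j \<in> {1..p}. \<bar>\<beta> j\<bar> = c i}"

text \<open>The vector \<open>\<beta>(z)\<close>, where \<open>K\<close> is the cluster that is moved.\<close>

definition beta_at :: "(nat \<Rightarrow> real) \<Rightarrow> nat set \<Rightarrow> real \<Rightarrow> nat \<Rightarrow> real" where
  "beta_at \<beta> K z i = (if i \<in> K then sign1 (\<beta> i) * z else \<beta> i)"

definition sorting_perm :: "nat \<Rightarrow> (nat \<Rightarrow> real) \<Rightarrow> (nat \<Rightarrow> nat) \<Rightarrow> bool" where
  "sorting_perm p b s \<longleftrightarrow> s permutes {1..p} \<and> antimono_on {1..p} (\<lambda>i. \<bar>b (s i)\<bar>)"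

text \<open>
  In what follows \<open>\<sigma> z\<close> is the chosen sorting permutation for \<open>\<beta>(z)\<close>, so that
  \<open>inv (\<sigma> z) j\<close> is the rank of the index \<open>j\<close>.
\<close>

definition partial_sorted_l1 ::
  "nat \<Rightarrow> (nat \<Rightarrow> real) \<Rightarrow> nat set \<Rightarrow> (nat \<Rightarrow> real) \<Rightarrow> (real \<Rightarrow> nat \<Rightarrow> nat) \<Rightarrow> real \<Rightarrow> real" where
  "partial_sorted_l1 p \<beta> K lam \<sigma> z =
     \<bar>z\<bar> * (\<Sum>j\<in>K. lam (inv (\<sigma> z) j)) + (\<Sum>j\<in>{1..p} - K. \<bar>\<beta> j\<bar> * lam (inv (\<sigma> z) j))"

definition tied_set :: "nat \<Rightarrow> (nat \<Rightarrow> real) \<Rightarrow> nat set \<Rightarrow> real \<Rightarrow> nat set" where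
  "tied_set p \<beta> K z = {j \<in> {1..p}. \<bar>beta_at \<beta> K z j\<bar> = \<bar>z\<bar>}"

text \<open>The one-sided limit exists and equals \<open>D\<close>.\<close>

definition has_dir_deriv :: "(real \<Rightarrow> real) \<Rightarrow> real \<Rightarrow> real \<Rightarrow> real \<Rightarrow> bool" where
  "has_dir_deriv f z \<delta> D \<longleftrightarrow> ((\<lambda>h. (f (z + h * \<delta>) - f z) / h) \<longlongrightarrow> D) (at_right 0)"

end

theory Submission
  imports Defs
begin

text \<open>
  Write \<open>H(y) = \<Sum>j. \<bar>\<beta>(y) j\<bar> * \<lambda>(rank of j)\<close>; this sum is the same for every permutation that
  sorts \<open>\<bar>\<beta>(y)\<bar>\<close>. Choose a reference point \<open>w\<close> where the moved cluster is tied with no other one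
  and such that no other cluster value lies strictly between \<open>w\<close> and the points \<open>y\<close> near \<open>z\<close> on the
  side of \<open>\<delta>\<close>, in absolute value. Then \<open>\<sigma> w\<close> sorts \<open>\<beta>(y)\<close> for all these \<open>y\<close>, including \<open>y = z\<close>,
  so on them \<open>H\<close> is affine in \<open>\<bar>y\<bar>\<close> with slope the sum of the weights of the moved cluster.
\<close>

text \<open>Both arrangements list the same multiset of values, and a multiset has only one sorted
  list. The values are negated because \<open>sorted\<close> means ascending.\<close>

lemma antimono_on_permutes_unique:
  fixes f :: "nat \<Rightarrow> real"
  assumes "s permutes {1..p}" "t permutes {1..p}"
    and "antimono_on {1..p} (\<lambda>i. f (s i))" "antimono_on {1..p} (\<lambda>i. f (t i))"
    and "i \<in> {1..p}"
  shows "f (s i) = f (t i)"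
proof -
  define L where "L u = map (\<lambda>i. - f (u i)) [1..<Suc p]" for u
  have sorted: "sorted (L u)" if "antimono_on {1..p} (\<lambda>i. f (u i))" for u
    unfolding L_def sorted_map
    by (rule sorted_wrt_mono_rel[OF _ sorted_upt])
       (use that in \<open>auto simp: monotone_on_def\<close>)
  have mset: "mset (L u) = image_mset (\<lambda>j. - f j) (mset_set {1..p})" if "u permutes {1..p}" for u
  proof -
    have "mset (L u) = image_mset (\<lambda>j. - f j) (image_mset u (mset_set {1..p}))"
      by (simp add: L_def image_mset.compositionality comp_def atLeastLessThanSuc_atLeastAtMost
          del: upt_Suc)
    also have "image_mset u (mset_set {1..p}) = mset_set {1..p}"
      using that by (simp add: image_mset_mset_set permutes_inj_on permutes_image)
    finally show ?thesis .
  qed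
  have "L s = L t"
    using properties_for_sort[of "L s" "L t"] properties_for_sort[of "L t" "L t"]
      sorted mset assms by metis
  \<comment> \<open>List positions count from 0 and ranks from 1.\<close>
  moreover have "L u ! (i - 1) = - f (u i)" for u
  proof -
    have "i - 1 < length [1..<Suc p]" "[1..<Suc p] ! (i - 1) = i"
      using assms(5) nth_upt[of 1 "i - 1" "Suc p"] by auto
    then show ?thesis by (simp only: L_def nth_map)
  qed
  ultimately show ?thesis by (metis neg_equal_iff_equal)
qed

text \<open>Reindexing by rank pairs \<open>lam i\<close> with the \<open>i\<close>-th largest
  absolute value, which does not depend on how ties are broken.\<close>

lemma sorting_perm_sum_unique:
  assumes "sorting_perm p b s" "sorting_perm p b t"
  shows "(\<Sum>j\<in>{1..p}. \<bar>b j\<bar> * lam (inv s j)) = (\<Sum>j\<in>{1..p}. \<bar>b j\<bar> * lam (inv t j))"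
proof -
  have ranks: "(\<Sum>j\<in>{1..p}. \<bar>b j\<bar> * lam (inv u j)) = (\<Sum>i\<in>{1..p}. \<bar>b (u i)\<bar> * lam i)"
    if "sorting_perm p b u" for u
    using that sum.permute[of u "{1..p}" "\<lambda>j. \<bar>b j\<bar> * lam (inv u j)"]
    by (auto simp: sorting_perm_def comp_def permutes_inverses(2))
  have "\<bar>b (s i)\<bar> = \<bar>b (t i)\<bar>" if "i \<in> {1..p}" for i
    using antimono_on_permutes_unique[of s p t "\<lambda>j. \<bar>b j\<bar>" i] assms that
    by (simp add: sorting_perm_def)
  then show ?thesis
    unfolding ranks[OF assms(1)] ranks[OF assms(2)] by (intro sum.cong) simp_all
qed

text \<open>Strict inequalities of \<open>b\<close> may collapse to ties in \<open>b'\<close>, but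
  ties of \<open>b\<close> must remain ties.\<close>

lemma sorting_perm_transfer:
  assumes "sorting_perm p b s"
    and "\<And>i j. i \<in> {1..p} \<Longrightarrow> j \<in> {1..p} \<Longrightarrow> \<bar>b i\<bar> \<le> \<bar>b j\<bar> \<Longrightarrow> \<bar>b' i\<bar> \<le> \<bar>b' j\<bar>"
  shows "sorting_perm p b' s"
  using assms permutes_in_image[of s "{1..p}"]
  unfolding sorting_perm_def monotone_on_def by blast

lemma abs_sign1 [simp]: "\<bar>sign1 x\<bar> = 1"
  by (simp add: sign1_def)

lemma abs_beta_at: "\<bar>beta_at \<beta> K y j\<bar> = (if j \<in> K then \<bar>y\<bar> else \<bar>\<beta> j\<bar>)"
  by (simp add: beta_at_def abs_mult)

text \<open>The two sums in the definition can each depend on the tie-breaking; merged into one sum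
  over all indices, they fall under \<open>sorting_perm_sum_unique\<close>.\<close>

lemma partial_sorted_l1_eq_sum:
  assumes "K \<subseteq> {1..p}"
  shows "partial_sorted_l1 p \<beta> K lam \<sigma> y
    = (\<Sum>j\<in>{1..p}. \<bar>beta_at \<beta> K y j\<bar> * lam (inv (\<sigma> y) j))"
  using assms sum.subset_diff[of K "{1..p}" "\<lambda>j. \<bar>beta_at \<beta> K y j\<bar> * lam (inv (\<sigma> y) j)"]
  by (simp add: partial_sorted_l1_def abs_beta_at sum_distrib_left)

text \<open>The asymmetry is deliberate: \<open>w\<close> must avoid every value in
  \<open>J\<close>, whereas \<open>y\<close> may reach such a value but not pass it. This lets
  \<open>y\<close> be a point \<open>z\<close> at which clusters merge.\<close>

definition order_compatible :: "nat set \<Rightarrow> (nat \<Rightarrow> real) \<Rightarrow> real \<Rightarrow> real \<Rightarrow> bool" where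
  "order_compatible J \<beta> w y \<longleftrightarrow> (\<forall>j\<in>J. \<bar>\<beta> j\<bar> \<noteq> \<bar>w\<bar> \<and>
     (\<bar>\<beta> j\<bar> < \<bar>w\<bar> \<longrightarrow> \<bar>\<beta> j\<bar> \<le> \<bar>y\<bar>) \<and> (\<bar>w\<bar> < \<bar>\<beta> j\<bar> \<longrightarrow> \<bar>y\<bar> \<le> \<bar>\<beta> j\<bar>))"

lemma tied_set_eq_cluster:
  assumes "K \<subseteq> {1..p}" "order_compatible ({1..p} - K) \<beta> w y"
  shows "tied_set p \<beta> K w = K"
  using assms by (auto simp: tied_set_def abs_beta_at order_compatible_def)

lemma partial_sorted_l1_order_compatible:
  assumes K: "K \<subseteq> {1..p}"
    and sorting: "\<And>x. sorting_perm p (beta_at \<beta> K x) (\<sigma> x)"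
    and compat: "order_compatible ({1..p} - K) \<beta> w y"
  shows "partial_sorted_l1 p \<beta> K lam \<sigma> y
    = \<bar>y\<bar> * (\<Sum>j\<in>K. lam (inv (\<sigma> w) j)) + (\<Sum>j\<in>{1..p} - K. \<bar>\<beta> j\<bar> * lam (inv (\<sigma> w) j))"
proof -
  have "sorting_perm p (beta_at \<beta> K y) (\<sigma> w)"
  proof (rule sorting_perm_transfer[OF sorting[of w]])
    fix i j assume "i \<in> {1..p}" "j \<in> {1..p}" "\<bar>beta_at \<beta> K w i\<bar> \<le> \<bar>beta_at \<beta> K w j\<bar>"
    then show "\<bar>beta_at \<beta> K y i\<bar> \<le> \<bar>beta_at \<beta> K y j\<bar>"
      using compat by (force simp: abs_beta_at order_compatible_def split: if_splits)
  qed
  then have "partial_sorted_l1 p \<beta> K lam \<sigma> y = partial_sorted_l1 p \<beta> K lam (\<lambda>_. \<sigma> w) y"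
    unfolding partial_sorted_l1_eq_sum[OF K] by (rule sorting_perm_sum_unique[OF sorting])
  then show ?thesis
    by (simp add: partial_sorted_l1_def)
qed

text \<open>Since \<open>z\<close> and the nearby points share one formula affine in the absolute
  value, the difference quotient is eventually constant. Here \<open>r\<close> is the one-sided
  slope of the absolute value at \<open>z\<close>.\<close>

lemma has_dir_deriv_partial_sorted_l1:
  assumes K: "K \<subseteq> {1..p}"
    and sorting: "\<And>x. sorting_perm p (beta_at \<beta> K x) (\<sigma> x)"
    and compat: "order_compatible ({1..p} - K) \<beta> w z"
    and near: "\<forall>\<^sub>F h in at_right 0. order_compatible ({1..p} - K) \<beta> w (z + h * \<delta>)"
    and abs: "\<forall>\<^sub>F h in at_right 0. \<bar>z + h * \<delta>\<bar> = \<bar>z\<bar> + h * r"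
  shows "has_dir_deriv (partial_sorted_l1 p \<beta> K lam \<sigma>) z \<delta>
    (r * (\<Sum>j\<in>tied_set p \<beta> K w. lam (inv (\<sigma> w) j)))"
  unfolding has_dir_deriv_def
proof (rule tendsto_eventually)
  let ?H = "partial_sorted_l1 p \<beta> K lam \<sigma>"
  show "\<forall>\<^sub>F h in at_right 0. (?H (z + h * \<delta>) - ?H z) / h
    = r * (\<Sum>j\<in>tied_set p \<beta> K w. lam (inv (\<sigma> w) j))"
    using near abs eventually_at_right_less[of 0]
  proof eventually_elim
    case (elim h)
    then show ?case
      using partial_sorted_l1_order_compatible[OF K sorting compat]
        partial_sorted_l1_order_compatible[OF K sorting elim(1)]
      by (simp add: tied_set_eq_cluster[OF K compat] field_simps)
  qed
qed

text \<open>An untied \<open>z\<close> can be its own reference point: by continuity, a short step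
  crosses none of finitely many values different from \<bar>z\<bar>.\<close>

lemma eventually_order_compatible_self:
  assumes "finite J" "\<And>j. j \<in> J \<Longrightarrow> \<bar>\<beta> j\<bar> \<noteq> \<bar>z\<bar>"
  shows "\<forall>\<^sub>F h in at_right 0. order_compatible J \<beta> z (z + h * \<delta>)"
  unfolding order_compatible_def
proof (intro eventually_ball_finite assms(1) ballI)
  fix j assume "j \<in> J"
  have lim: "((\<lambda>h. \<bar>z + h * \<delta>\<bar>) \<longlongrightarrow> \<bar>z\<bar>) (at_right 0)"
    by (auto intro!: tendsto_eq_intros)
  consider "\<bar>\<beta> j\<bar> < \<bar>z\<bar>" | "\<bar>z\<bar> < \<bar>\<beta> j\<bar>"
    using assms(2)[OF \<open>j \<in> J\<close>] by linarith
  then show "\<forall>\<^sub>F h in at_right 0. \<bar>\<beta> j\<bar> \<noteq> \<bar>z\<bar> \<and> (\<bar>\<beta> j\<bar> < \<bar>z\<bar> \<longrightarrow> \<bar>\<beta> j\<bar> \<le> \<bar>z + h * \<delta>\<bar>) \<and>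
      (\<bar>z\<bar> < \<bar>\<beta> j\<bar> \<longrightarrow> \<bar>z + h * \<delta>\<bar> \<le> \<bar>\<beta> j\<bar>)"
  proof cases
    case 1
    show ?thesis
      using order_tendstoD(1)[OF lim 1] by eventually_elim (use 1 in auto)
  next
    case 2
    show ?thesis
      using order_tendstoD(2)[OF lim 2] by eventually_elim (use 2 in auto)
  qed
qed

theorem theorem2p2:
  fixes p m k :: nat
    and \<beta> c lam :: "nat \<Rightarrow> real"
    and \<sigma> :: "real \<Rightarrow> nat \<Rightarrow> nat"
    and \<epsilon> z \<delta> :: real
  defines "K \<equiv> cluster p \<beta> c k"
  defines "H \<equiv> partial_sorted_l1 p \<beta> K lam \<sigma>"
  assumes lam_mono: "antimono_on {1..p} lam"
    and lam_nonneg: "0 \<le> lam p"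
    and clusters: "cluster_values p \<beta> m c"
    and k: "k \<in> {1..m}"
    and sorting: "\<And>x. sorting_perm p (beta_at \<beta> K x) (\<sigma> x)"
    and eps_pos: "0 < \<epsilon>"
    and eps_gap: "\<And>i j. i \<in> {1..m} \<Longrightarrow> j \<in> {1..m} \<Longrightarrow> i \<noteq> j \<Longrightarrow> \<epsilon> < \<bar>c i - c j\<bar>"
    and eps_last: "c m \<noteq> 0 \<Longrightarrow> \<epsilon> < c m"
    and delta: "\<delta> \<in> {-1, 1}"
  shows "has_dir_deriv H z \<delta>
    (if z = 0 then
       \<Sum>j\<in>tied_set p \<beta> K \<epsilon>. lam (inv (\<sigma> \<epsilon>) j)
     else if \<bar>z\<bar> \<in> c ` ({1..m} - {k}) - {0} then
       sign1 z * \<delta> * (\<Sum>j\<in>tied_set p \<beta> K (z + \<epsilon> * \<delta>). lam (inv (\<sigma> (z + \<epsilon> * \<delta>)) j))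
     else
       sign1 z * \<delta> * (\<Sum>j\<in>tied_set p \<beta> K z. lam (inv (\<sigma> z) j)))"
proof -
  have K: "K \<subseteq> {1..p}"
    by (auto simp: K_def cluster_def)
  have cluster_value: "\<exists>i\<in>{1..m} - {k}. \<bar>\<beta> j\<bar> = c i" if "j \<in> {1..p} - K" for j
  proof -
    have "\<bar>\<beta> j\<bar> \<in> c ` {1..m}"
      using clusters that unfolding cluster_values_def by blast
    with that show ?thesis
      by (auto simp: K_def cluster_def)
  qed
  have m: "m \<in> {1..m}"
    using k by auto
  \<comment> \<open>If \<open>c m\<close> is nonzero, it exceeds \<epsilon> and is the least value;
    if it is zero, the gap between \<open>c i\<close> and \<open>c m\<close> is \<open>c i\<close>
    itself.\<close>
  have gap: "\<epsilon> < \<bar>c i\<bar>" if "i \<in> {1..m}" "c i \<noteq> 0" for i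
  proof -
    have "c m \<in> (\<lambda>j. \<bar>\<beta> j\<bar>) ` {1..p}"
      using clusters m unfolding cluster_values_def by blast
    then have "0 \<le> c m" by auto
    have "c m < c i" if "i \<noteq> m"
      using clusters \<open>i \<in> {1..m}\<close> m that by (auto simp: cluster_values_def monotone_on_def)
    with \<open>0 \<le> c m\<close> that eps_gap[OF that(1) m] eps_last show ?thesis
      by (cases "i = m"; cases "c m = 0") auto
  qed
  have small: "\<forall>\<^sub>F h in at_right 0. 0 < h \<and> h < d" if "0 < d" for d :: real
    using that by (auto simp: eventually_at_right_field)
  have abs: "\<forall>\<^sub>F h in at_right 0. \<bar>z + h * \<delta>\<bar> = \<bar>z\<bar> + h * (sign1 z * \<delta>)" if "z \<noteq> 0"
  proof -
    \<comment> \<open>Steps shorter than \<bar>z\<bar> do not change the sign.\<close>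
    have "0 < \<bar>z\<bar>" using that by simp
    from small[OF this] show ?thesis
      by eventually_elim (use that delta in \<open>auto simp: sign1_def abs_if split: if_splits\<close>)
  qed
  note deriv = has_dir_deriv_partial_sorted_l1[where lam = lam, OF K sorting]
  consider "z = 0" | i where "z \<noteq> 0" "i \<in> {1..m} - {k}" "\<bar>z\<bar> = c i"
    | "z \<noteq> 0" "\<bar>z\<bar> \<notin> c ` ({1..m} - {k}) - {0}"
    by blast
  then show ?thesis
  proof cases
    case 1
    \<comment> \<open>By \<open>gap\<close>, the only value another cluster can have in the interval
      from 0 to \<epsilon> is 0, and \<bar>y\<bar> cannot pass below that.\<close>
    have compat: "order_compatible ({1..p} - K) \<beta> \<epsilon> y" if "\<bar>y\<bar> \<le> \<epsilon>" for y
      unfolding order_compatible_def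
    proof
      fix j assume "j \<in> {1..p} - K"
      then obtain i where "i \<in> {1..m}" "\<bar>\<beta> j\<bar> = c i"
        using cluster_value by blast
      with gap[of i] that eps_pos
      show "\<bar>\<beta> j\<bar> \<noteq> \<bar>\<epsilon>\<bar> \<and> (\<bar>\<beta> j\<bar> < \<bar>\<epsilon>\<bar> \<longrightarrow> \<bar>\<beta> j\<bar> \<le> \<bar>y\<bar>) \<and> (\<bar>\<epsilon>\<bar> < \<bar>\<beta> j\<bar> \<longrightarrow> \<bar>y\<bar> \<le> \<bar>\<beta> j\<bar>)"
        by (cases "c i = 0") auto
    qed
    \<comment> \<open>At 0 the absolute value has slope 1 in both directions; the factor is written
      out to match \<open>r\<close> in \<open>deriv\<close>.\<close>
    have "has_dir_deriv H z \<delta> (1 * (\<Sum>j\<in>tied_set p \<beta> K \<epsilon>. lam (inv (\<sigma> \<epsilon>) j)))"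
      unfolding H_def
    proof (rule deriv)
      show "order_compatible ({1..p} - K) \<beta> \<epsilon> z"
        using 1 eps_pos by (intro compat) simp
      show "\<forall>\<^sub>F h in at_right 0. order_compatible ({1..p} - K) \<beta> \<epsilon> (z + h * \<delta>)"
        using small[OF eps_pos] by eventually_elim (rule compat, use 1 delta in auto)
      show "\<forall>\<^sub>F h in at_right 0. \<bar>z + h * \<delta>\<bar> = \<bar>z\<bar> + h * 1"
        using small[OF eps_pos] by eventually_elim (use 1 delta in auto)
    qed
    with 1 show ?thesis by simp
  next
    case (2 i)
    \<comment> \<open>The whole step to the reference point stays on one side of 0, so the absolute
      value is affine along it.\<close>
    have "\<epsilon> < \<bar>z\<bar>"
      using gap[of i] 2 by auto
    then have step: "\<bar>z + h * \<delta>\<bar> = \<bar>z\<bar> + h * (sign1 z * \<delta>)" if "0 \<le> h" "h \<le> \<epsilon>" for h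
      using that delta by (auto simp: sign1_def abs_if split: if_splits)
    have side: "sign1 z * \<delta> = 1 \<or> sign1 z * \<delta> = - 1"
      using delta by (auto simp: sign1_def abs_if)
    have compat: "order_compatible ({1..p} - K) \<beta> (z + \<epsilon> * \<delta>) (z + h * \<delta>)"
      if h: "0 \<le> h" "h \<le> \<epsilon>" for h
      unfolding order_compatible_def
    proof
      fix j assume "j \<in> {1..p} - K"
      then obtain l where l: "l \<in> {1..m} - {k}" "\<bar>\<beta> j\<bar> = c l"
        using cluster_value by blast
      \<comment> \<open>Other values equal \<bar>z\<bar> or lie more than \<epsilon> away, so the
        step meets one at most at its starting point.\<close>
      have "\<bar>\<beta> j\<bar> = \<bar>z\<bar> \<or> \<bar>\<beta> j\<bar> + \<epsilon> < \<bar>z\<bar> \<or> \<bar>z\<bar> + \<epsilon> < \<bar>\<beta> j\<bar>"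
        using l 2 eps_gap[of l i] by (cases "l = i") (auto simp: abs_if split: if_splits)
      with side h eps_pos step[OF h] step[of \<epsilon>]
      show "\<bar>\<beta> j\<bar> \<noteq> \<bar>z + \<epsilon> * \<delta>\<bar> \<and> (\<bar>\<beta> j\<bar> < \<bar>z + \<epsilon> * \<delta>\<bar> \<longrightarrow> \<bar>\<beta> j\<bar> \<le> \<bar>z + h * \<delta>\<bar>) \<and>
          (\<bar>z + \<epsilon> * \<delta>\<bar> < \<bar>\<beta> j\<bar> \<longrightarrow> \<bar>z + h * \<delta>\<bar> \<le> \<bar>\<beta> j\<bar>)"
        by auto
    qed
    have "has_dir_deriv H z \<delta> (sign1 z * \<delta> *
        (\<Sum>j\<in>tied_set p \<beta> K (z + \<epsilon> * \<delta>). lam (inv (\<sigma> (z + \<epsilon> * \<delta>)) j)))"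
      unfolding H_def
    proof (rule deriv[OF _ _ abs[OF 2(1)]])
      show "order_compatible ({1..p} - K) \<beta> (z + \<epsilon> * \<delta>) z"
        using compat[of 0] eps_pos by simp
      show "\<forall>\<^sub>F h in at_right 0. order_compatible ({1..p} - K) \<beta> (z + \<epsilon> * \<delta>) (z + h * \<delta>)"
        using small[OF eps_pos] by eventually_elim (rule compat, auto)
    qed
    moreover have "\<bar>z\<bar> \<in> c ` ({1..m} - {k}) - {0}"
      using 2 by auto
    ultimately show ?thesis
      using 2(1) by simp
  next
    case 3
    \<comment> \<open>As \<open>z\<close> is nonzero, removing 0 from the set of values does not
      matter here: \<bar>z\<bar> is no value of another cluster.\<close>
    have untied: "\<bar>\<beta> j\<bar> \<noteq> \<bar>z\<bar>" if "j \<in> {1..p} - K" for j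
      using cluster_value[OF that] 3 by auto
    have "has_dir_deriv H z \<delta> (sign1 z * \<delta> * (\<Sum>j\<in>tied_set p \<beta> K z. lam (inv (\<sigma> z) j)))"
      unfolding H_def
    proof (rule deriv[OF _ _ abs[OF 3(1)]])
      show "order_compatible ({1..p} - K) \<beta> z z"
        using untied by (auto simp: order_compatible_def)
      show "\<forall>\<^sub>F h in at_right 0. order_compatible ({1..p} - K) \<beta> z (z + h * \<delta>)"
        using untied by (intro eventually_order_compatible_self) auto
    qed
    with 3 show ?thesis by auto
  qed
qed

end
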